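(* Let $X$ be a Banach space of dimension at least two such that the pair $(X,X)$ has the BPBp-RSE. Then $\operatorname{str-exp}(B_X)$ is dense in $S_X$. In particular, density of $\operatorname{str-exp}(B_X)$ in $S_X$ is a necessary condition for $X$ to be a universal BPBp-RSE domain space, and also for $X$ to be a universal BPBp-RSE range space.
   Context: Banach spaces are over $\mathbb K\in\{\mathbb R,\mathbb C\}$ and have dimension at least two; $B_X$, $S_X$ are the closed unit ball and unit sphere of $X$; $\mathbb T=\{\lambda\in\mathbb K:|\lambda|=1\}$; $\mathcal L(X,Y)$ is the space of bounded linear operators. $\operatorname{str-exp}(B_X)$ is the set of strongly exposed points of $B_X$: those $x_0\in B_X$ for which there is $x^*\in X^*\setminus\{0\}$ with $\mathrm{Re}\,x^*(x_0)=\sup_{x\in B_X}\mathrm{Re}\,x^*(x)$ and such that every sequence $(x_n)\subseteq B_X$ with $\mathrm{Re}\,x^*(x_n)\to\mathrm{Re}\,x^*(x_0)$ converges in norm to $x_0$. $T\in\mathrm{RSE}(X,Y)$ (range strongly exposing) if there is $x_0\in S_X$ such that whenever $(x_n)\subseteq B_X$ satisfies $\|Tx_n\|\to\|T\|$, there are a subsequence $(x_{\sigma(n)})$ and $\lambda\in\mathbb T$ with $Tx_{\sigma(n)}\to\lambda Tx_0$. The pair $(X,Y)$ has the BPBp-RSE if for every $\varepsilon>0$ there is $0<\eta(\varepsilon)<\varepsilon$ such that for every $T\in\mathcal L(X,Y)$ with $\|T\|=1$ and every $x\in S_X$ with $\|Tx\|>1-\eta(\varepsilon)$, there exist $S\in\mathrm{RSE}(X,Y)$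 and $x_0\in S_X$ with $\|S\|=\|Sx_0\|=1$, $\|S-T\|<\varepsilon$ and $\|x-x_0\|<\varepsilon$. $X$ is a universal BPBp-RSE domain space if $(X,Z)$ has the BPBp-RSE for every Banach space $Z$, and a universal BPBp-RSE range space if $(Z,X)$ has the BPBp-RSE for every Banach space $Z$. *)

theory Defs
  imports "HOL-Algebra.Module" "HOL-Analysis.Analysis"
begin

text \<open>
  Universal domain and range spaces quantify over all Banach spaces inside a hypothesis, so
  Banach spaces are carrier-based structures. The type \<open>'a\<close> of the ambient elements acts as
  the universe: it is arbitrary, and \<open>X\<close> lives on any subset of it.

  The scalar field is a set \<open>K\<close> of complex numbers, either the reals or everything. The record
  for \<open>K\<close>-normed spaces extends the module record, whose inherited \<open>mult\<close> and \<open>one\<close>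
  (of the ring record) are unused, as is \<open>smult\<close> on scalars outside \<open>K\<close>.
\<close>

record 'a nspace = "(complex, 'a) module" +
  vnorm :: "'a \<Rightarrow> real"

definition scalar_ring :: "complex set \<Rightarrow> complex ring" where
  "scalar_ring K = \<lparr>carrier = K, monoid.mult = (*), one = 1, zero = 0, add = (+)\<rparr>"

text \<open>The case distinction is there because \<^locale>\<open>Metric_space\<close> constrains the distance
  function on the whole type, not only on the carrier.\<close>

definition ndist :: "'a nspace \<Rightarrow> 'a \<Rightarrow> 'a \<Rightarrow> real" where
  "ndist X x y =
    (if x \<in> carrier X \<and> y \<in> carrier X then vnorm X (x \<ominus>\<^bsub>X\<^esub> y) else 0)"

definition norm_topology :: "'a nspace \<Rightarrow> 'a topology" where
  "norm_topology X = Metric_space.mtopology (carrier X) (ndist X)"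

locale normed_space = Module.module "scalar_ring K" X
  for K :: "complex set" and X :: "'a nspace" (structure) +
  assumes scalars: "K = \<real> \<or> K = UNIV"
    and vnorm_eq_zero: "x \<in> carrier X \<Longrightarrow> vnorm X x = 0 \<longleftrightarrow> x = \<zero>\<^bsub>X\<^esub>"
    and vnorm_smult: "\<lbrakk>a \<in> K; x \<in> carrier X\<rbrakk> \<Longrightarrow> vnorm X (a \<odot>\<^bsub>X\<^esub> x) = cmod a * vnorm X x"
    and vnorm_triangle: "\<lbrakk>x \<in> carrier X; y \<in> carrier X\<rbrakk> \<Longrightarrow>
      vnorm X (x \<oplus>\<^bsub>X\<^esub> y) \<le> vnorm X x + vnorm X y"

locale banach_space = normed_space +
  assumes complete: "Metric_space.mcomplete (carrier X) (ndist X)"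

definition dim_ge_two :: "complex set \<Rightarrow> 'a nspace \<Rightarrow> bool" where
  "dim_ge_two K X \<longleftrightarrow> (\<exists>x\<in>carrier X. \<exists>y\<in>carrier X. \<forall>a\<in>K. \<forall>b\<in>K.
     a \<odot>\<^bsub>X\<^esub> x \<oplus>\<^bsub>X\<^esub> b \<odot>\<^bsub>X\<^esub> y = \<zero>\<^bsub>X\<^esub> \<longrightarrow> a = 0 \<and> b = 0)"

definition scalar_space :: "complex set \<Rightarrow> complex nspace" where
  "scalar_space K = \<lparr>carrier = K, monoid.mult = (*), one = 1, zero = 0, add = (+),
     module.smult = (*), vnorm = cmod\<rparr>"

definition unit_ball :: "'a nspace \<Rightarrow> 'a set" where
  "unit_ball X = {x \<in> carrier X. vnorm X x \<le> 1}"

definition unit_sphere :: "'a nspace \<Rightarrow> 'a set" where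
  "unit_sphere X = {x \<in> carrier X. vnorm X x = 1}"

text \<open>Operators are functions on the whole type; only their values on \<open>carrier X\<close> matter.\<close>

definition bounded_ops :: "complex set \<Rightarrow> 'a nspace \<Rightarrow> 'b nspace \<Rightarrow> ('a \<Rightarrow> 'b) set" where
  "bounded_ops K X Y = {T. T \<in> carrier X \<rightarrow> carrier Y
     \<and> (\<forall>x\<in>carrier X. \<forall>y\<in>carrier X. T (x \<oplus>\<^bsub>X\<^esub> y) = T x \<oplus>\<^bsub>Y\<^esub> T y)
     \<and> (\<forall>a\<in>K. \<forall>x\<in>carrier X. T (a \<odot>\<^bsub>X\<^esub> x) = a \<odot>\<^bsub>Y\<^esub> T x)
     \<and> (\<exists>C. \<forall>x\<in>carrier X. vnorm Y (T x) \<le> C * vnorm X x)}"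

definition op_norm :: "'a nspace \<Rightarrow> 'b nspace \<Rightarrow> ('a \<Rightarrow> 'b) \<Rightarrow> real" where
  "op_norm X Y T = (SUP x\<in>unit_ball X. vnorm Y (T x))"

definition dual :: "complex set \<Rightarrow> 'a nspace \<Rightarrow> ('a \<Rightarrow> complex) set" where
  "dual K X = bounded_ops K X (scalar_space K)"

definition strongly_exposed_points :: "complex set \<Rightarrow> 'a nspace \<Rightarrow> 'a set" where
  "strongly_exposed_points K X = {x0 \<in> unit_ball X. \<exists>f\<in>dual K X.
     (\<exists>x\<in>carrier X. f x \<noteq> 0)
     \<and> Re (f x0) = (SUP x\<in>unit_ball X. Re (f x))
     \<and> (\<forall>x :: nat \<Rightarrow> 'a. range x \<subseteq> unit_ball X \<and> (\<lambda>n. Re (f (x n))) \<longlonglongrightarrow> Re (f x0)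
          \<longrightarrow> limitin (norm_topology X) x x0 sequentially)}"

definition RSE :: "complex set \<Rightarrow> 'a nspace \<Rightarrow> 'b nspace \<Rightarrow> ('a \<Rightarrow> 'b) set" where
  "RSE K X Y = {T \<in> bounded_ops K X Y. \<exists>x0\<in>unit_sphere X. \<forall>x :: nat \<Rightarrow> 'a.
     range x \<subseteq> unit_ball X \<and> (\<lambda>n. vnorm Y (T (x n))) \<longlonglongrightarrow> op_norm X Y T \<longrightarrow>
     (\<exists>\<sigma> :: nat \<Rightarrow> nat. \<exists>c\<in>K. strict_mono \<sigma> \<and> cmod c = 1
        \<and> limitin (norm_topology Y) (\<lambda>n. T (x (\<sigma> n))) (c \<odot>\<^bsub>Y\<^esub> T x0) sequentially)}"

definition BPBp_RSE :: "complex set \<Rightarrow> 'a nspace \<Rightarrow> 'b nspace \<Rightarrow> bool" where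
  "BPBp_RSE K X Y \<longleftrightarrow> (\<forall>\<epsilon>>0. \<exists>\<eta>. 0 < \<eta> \<and> \<eta> < \<epsilon> \<and>
     (\<forall>T\<in>bounded_ops K X Y. \<forall>x\<in>unit_sphere X.
        op_norm X Y T = 1 \<and> vnorm Y (T x) > 1 - \<eta> \<longrightarrow>
        (\<exists>S\<in>RSE K X Y. \<exists>x0\<in>unit_sphere X.
           op_norm X Y S = 1 \<and> vnorm Y (S x0) = 1
           \<and> op_norm X Y (\<lambda>u. S u \<ominus>\<^bsub>Y\<^esub> T u) < \<epsilon>
           \<and> vnorm X (x \<ominus>\<^bsub>X\<^esub> x0) < \<epsilon>)))"

text \<open>Here \<open>Z\<close> ranges over the Banach spaces in the universe \<open>'a\<close> of \<open>X\<close>, with the standing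
  convention that Banach spaces have dimension at least two. Universality over all Banach spaces
  implies these predicates, for every choice of \<open>'a\<close> containing a copy of \<open>X\<close>.\<close>

definition universal_BPBp_RSE_domain :: "complex set \<Rightarrow> 'a nspace \<Rightarrow> bool" where
  "universal_BPBp_RSE_domain K X \<longleftrightarrow>
     (\<forall>Z :: 'a nspace. banach_space K Z \<and> dim_ge_two K Z \<longrightarrow> BPBp_RSE K X Z)"

definition universal_BPBp_RSE_range :: "complex set \<Rightarrow> 'a nspace \<Rightarrow> bool" where
  "universal_BPBp_RSE_range K X \<longleftrightarrow>
     (\<forall>Z :: 'a nspace. banach_space K Z \<and> dim_ge_two K Z \<longrightarrow> BPBp_RSE K Z X)"

definition dense_in_sphere :: "'a nspace \<Rightarrow> 'a set \<Rightarrow> bool" where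
  "dense_in_sphere X A \<longleftrightarrow>
     A \<subseteq> unit_sphere X \<and> unit_sphere X \<subseteq> norm_topology X closure_of A"

lemma (in normed_space) scalar_ring_carrier [simp]:
  "carrier (scalar_ring K) = K" "\<one>\<^bsub>scalar_ring K\<^esub> = 1" "\<zero>\<^bsub>scalar_ring K\<^esub> = 0"
  "a \<oplus>\<^bsub>scalar_ring K\<^esub> b = a + b" "a \<otimes>\<^bsub>scalar_ring K\<^esub> b = a * b"
  by (simp_all add: scalar_ring_def)

lemma (in normed_space) minus_eq_smult:
  assumes "x \<in> carrier X"
  shows "\<ominus>\<^bsub>X\<^esub> x = (-1) \<odot>\<^bsub>X\<^esub> x"
proof -
  have K: "(-1) \<in> K" "1 \<in> K" using scalars by auto
  have "(-1) \<odot>\<^bsub>X\<^esub> x \<oplus>\<^bsub>X\<^esub> x = (-1) \<odot>\<^bsub>X\<^esub> x \<oplus>\<^bsub>X\<^esub> 1 \<odot>\<^bsub>X\<^esub> x"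
    using smult_one assms by simp
  also have "\<dots> = (-1 + 1) \<odot>\<^bsub>X\<^esub> x"
    using smult_l_distr[of "-1" 1 x] K assms by simp
  also have "\<dots> = \<zero>\<^bsub>X\<^esub>"
    using smult_l_null[of x] assms by simp
  finally have "(-1) \<odot>\<^bsub>X\<^esub> x \<oplus>\<^bsub>X\<^esub> x = \<zero>\<^bsub>X\<^esub>" .
  moreover have "(-1) \<odot>\<^bsub>X\<^esub> x \<in> carrier X" using smult_closed[of "-1" x] K assms by simp
  ultimately show ?thesis
    using M.minus_equality[OF _ assms, of "(-1) \<odot>\<^bsub>X\<^esub> x"] by blast
qed

lemma (in normed_space) vnorm_uminus:
  assumes "x \<in> carrier X"
  shows "vnorm X (\<ominus>\<^bsub>X\<^esub> x) = vnorm X x"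
proof -
  have "(-1) \<in> K" using scalars by auto
  then show ?thesis using vnorm_smult[of "-1" x] assms by (simp add: minus_eq_smult)
qed

lemma (in normed_space) vnorm_nonneg:
  assumes "x \<in> carrier X"
  shows "0 \<le> vnorm X x"
proof -
  have "vnorm X \<zero>\<^bsub>X\<^esub> = 0" using vnorm_eq_zero by simp
  moreover have "vnorm X (x \<oplus>\<^bsub>X\<^esub> \<ominus>\<^bsub>X\<^esub> x) \<le> vnorm X x + vnorm X x"
    using vnorm_triangle[of x "\<ominus>\<^bsub>X\<^esub> x"] assms by (simp add: vnorm_uminus)
  ultimately show ?thesis using assms by (simp add: M.r_neg)
qed

lemma (in normed_space) Metric_space_ndist: "Metric_space (carrier X) (ndist X)"
proof
  fix x y show "0 \<le> ndist X x y"
    by (simp add: ndist_def vnorm_nonneg)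
next
  fix x y
  show "ndist X x y = ndist X y x"
  proof (cases "x \<in> carrier X \<and> y \<in> carrier X")
    case True
    then have "\<ominus>\<^bsub>X\<^esub> (x \<ominus>\<^bsub>X\<^esub> y) = y \<ominus>\<^bsub>X\<^esub> x"
      by (simp add: a_minus_def M.minus_add M.a_comm)
    then have "vnorm X (y \<ominus>\<^bsub>X\<^esub> x) = vnorm X (x \<ominus>\<^bsub>X\<^esub> y)"
      using True vnorm_uminus[of "x \<ominus>\<^bsub>X\<^esub> y"] by simp
    then show ?thesis by (simp add: ndist_def)
  qed (auto simp: ndist_def)
next
  fix x y assume A: "x \<in> carrier X" "y \<in> carrier X"
  then have "x \<ominus>\<^bsub>X\<^esub> y = \<zero>\<^bsub>X\<^esub> \<longleftrightarrow> x = y"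
    unfolding a_minus_def
    by (metis M.a_inv_closed M.minus_equality M.minus_minus M.r_neg)
  with A show "ndist X x y = 0 \<longleftrightarrow> x = y"
    by (simp add: ndist_def vnorm_eq_zero)
next
  fix x y z assume A: "x \<in> carrier X" "y \<in> carrier X" "z \<in> carrier X"
  then have "(x \<ominus>\<^bsub>X\<^esub> y) \<oplus>\<^bsub>X\<^esub> (y \<ominus>\<^bsub>X\<^esub> z) = x \<ominus>\<^bsub>X\<^esub> z"
    by (simp add: a_minus_def M.a_assoc M.r_neg1 M.r_neg2)
  then show "ndist X x z \<le> ndist X x y + ndist X y z"
    using vnorm_triangle[of "x \<ominus>\<^bsub>X\<^esub> y" "y \<ominus>\<^bsub>X\<^esub> z"] A by (simp add: ndist_def)
qed

lemma normed_space_scalar_space: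
  assumes "K = \<real> \<or> K = UNIV"
  shows "normed_space K (scalar_space K)"
proof -
  have neg: "- a \<in> K" if "a \<in> K" for a using assms that by auto
  have one: "0 \<in> K" "1 \<in> K" using assms by auto
  have add: "a + b \<in> K" and mul: "a * b \<in> K" if "a \<in> K" "b \<in> K" for a b
    using assms that by auto
  have "cring (scalar_ring K)"
  proof (rule cringI)
    show "abelian_group (scalar_ring K)"
      by (rule abelian_groupI)
        (use one add neg in \<open>auto simp: scalar_ring_def intro: bexI[of _ "- x" for x]\<close>)
    show "Group.comm_monoid (scalar_ring K)"
      by (rule comm_monoidI) (use one mul in \<open>auto simp: scalar_ring_def\<close>)
  qed (auto simp: scalar_ring_def algebra_simps)
  moreover have "abelian_group (scalar_space K)"
    by (rule abelian_groupI)
      (use one add neg in \<open>auto simp: scalar_space_def intro: bexI[of _ "- x" for x]\<close>)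
  ultimately have "Module.module (scalar_ring K) (scalar_space K)"
    by (rule moduleI) (use mul in \<open>auto simp: scalar_ring_def scalar_space_def algebra_simps\<close>)
  then show ?thesis
    using assms
    by (auto simp: normed_space_def normed_space_axioms_def scalar_space_def norm_mult
        norm_triangle_ineq)
qed

lemma banach_space_scalar_space:
  assumes "K = \<real> \<or> K = UNIV"
  shows "banach_space K (scalar_space K)"
proof -
  interpret S: normed_space K "scalar_space K"
    by (rule normed_space_scalar_space[OF assms])
  interpret D: Metric_space K "ndist (scalar_space K)"
    using S.Metric_space_ndist by (simp add: scalar_space_def)
  have d: "ndist (scalar_space K) x y = dist x y" if "x \<in> K" "y \<in> K" for x y
  proof -
    have "\<ominus>\<^bsub>scalar_space K\<^esub> y = - y"
      using S.minus_eq_smult[of y] that by (simp add: scalar_space_def)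
    then show ?thesis
      using that by (simp add: ndist_def a_minus_def scalar_space_def dist_norm)
  qed
  have cl: "closed K" using assms closed_complex_Reals by auto
  have "D.mcomplete"
    unfolding D.mcomplete_def
  proof (intro allI impI)
    fix s assume s: "D.MCauchy s"
    then have rK: "s n \<in> K" for n by (auto simp: D.MCauchy_def)
    have "Cauchy s"
      using s unfolding D.MCauchy_def Cauchy_def by (simp add: d rK)
    then obtain l where l: "s \<longlonglongrightarrow> l" using Cauchy_convergent convergent_def by blast
    then have lK: "l \<in> K" using closed_sequentially[OF cl] rK by blast
    have "limitin D.mtopology s l sequentially"
      using l unfolding D.limitin_metric tendsto_iff by (simp add: d rK lK)
    then show "\<exists>l. limitin D.mtopology s l sequentially" ..
  qed
  then show ?thesis
    by (simp add: banach_space_def banach_space_axioms_def S.normed_space_axioms)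
      (simp add: scalar_space_def)
qed

end

theory Submission
  imports Defs
begin

text \<open>
  The idea is to apply the approximation property of the pair \<open>(X, X)\<close> to the identity operator.
  Every \<open>x\<close> in the unit sphere attains the norm of the identity, so there are a range strongly
  exposing \<open>S\<close> of norm one close to the identity and a unit vector \<open>x0\<close> close to \<open>x\<close> at which \<open>S\<close>
  attains its norm. The definition of \<open>S\<close> being range strongly exposing gives convergence only of
  the images of maximizing sequences. But an operator at distance less than one from the identity
  is bounded below (\<open>bounded_below_near_id\<close>), so the sequences themselves converge, up to rotation,
  to \<open>x0\<close>. If \<open>g\<close> is a functional of norm one with \<open>g (S x0) = 1\<close>, then \<open>g \<circ> S\<close> also fixes the
  rotation and strongly exposes \<open>x0\<close> (\<open>strongly_exposed_point_if_RSE_bounded_below\<close>).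

  The functional \<open>g\<close> comes from the Hahn--Banach theorem (\<open>exists_norming_functional\<close>) for
  carrier-based spaces over the real or complex scalars. Instead of extending functionals from
  subspaces, its proof takes a minimal sublinear functional below a given one, which exists by
  Zorn's lemma; minimality makes it additive, hence real-linear.

  The two universal properties both specialize to the pair \<open>(X, X)\<close>.
\<close>

section \<open>Scalars, norms and bounded operators\<close>

context normed_space
begin

lemma of_real_in_scalars [simp]: "complex_of_real r \<in> K"
  using scalars by auto

lemma neg_one_in_scalars [simp]: "- 1 \<in> K"
  using of_real_in_scalars[of "- 1"] by simp

lemma zero_in_scalars [simp]: "0 \<in> K"
  using of_real_in_scalars[of 0] by simp

lemma scale_closed [simp]: "a \<in> K \<Longrightarrow> x \<in> carrier X \<Longrightarrow> a \<odot> x \<in> carrier X"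
  using smult_closed[of a x] by simp

lemma scale_add_right:
  "a \<in> K \<Longrightarrow> x \<in> carrier X \<Longrightarrow> y \<in> carrier X \<Longrightarrow> a \<odot> (x \<oplus> y) = a \<odot> x \<oplus> a \<odot> y"
  using smult_r_distr[of a x y] by simp

lemma scale_add_left:
  "a \<in> K \<Longrightarrow> b \<in> K \<Longrightarrow> x \<in> carrier X \<Longrightarrow> (a + b) \<odot> x = a \<odot> x \<oplus> b \<odot> x"
  using smult_l_distr[of a b x] by simp

lemma scale_scale:
  "a \<in> K \<Longrightarrow> b \<in> K \<Longrightarrow> x \<in> carrier X \<Longrightarrow> a \<odot> (b \<odot> x) = (a * b) \<odot> x"
  using smult_assoc1[of a b x] by simp

lemma scale_one [simp]: "x \<in> carrier X \<Longrightarrow> 1 \<odot> x = x"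
  using smult_one[of x] by simp

lemma scale_zero_left [simp]: "x \<in> carrier X \<Longrightarrow> 0 \<odot> x = \<zero>"
  using smult_l_null[of x] by simp

lemma vnorm_zero [simp]: "vnorm X \<zero> = 0"
  using vnorm_eq_zero by simp

lemma scale_diff_right:
  assumes "a \<in> K" "x \<in> carrier X" "y \<in> carrier X"
  shows "a \<odot> (x \<ominus> y) = a \<odot> x \<ominus> a \<odot> y"
  using assms
  by (simp add: a_minus_def minus_eq_smult scale_add_right scale_scale mult.commute)

lemma add_diff_add:
  assumes "x \<in> carrier X" "y \<in> carrier X" "u \<in> carrier X" "v \<in> carrier X"
  shows "(x \<oplus> y) \<ominus> (u \<oplus> v) = (x \<ominus> u) \<oplus> (y \<ominus> v)"
  using assms by (simp add: a_minus_def M.minus_add M.a_ac)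

lemma vnorm_diff_le:
  assumes "x \<in> carrier X" "y \<in> carrier X"
  shows "vnorm X (x \<ominus> y) \<le> vnorm X x + vnorm X y"
  using vnorm_triangle[of x "\<ominus> y"] assms by (simp add: a_minus_def vnorm_uminus)

lemma vnorm_diff_commute:
  assumes "x \<in> carrier X" "y \<in> carrier X"
  shows "vnorm X (x \<ominus> y) = vnorm X (y \<ominus> x)"
  using Metric_space.commute[OF Metric_space_ndist, of x y] assms by (simp add: ndist_def)

lemma vnorm_le_add_diff:
  assumes "x \<in> carrier X" "y \<in> carrier X"
  shows "vnorm X x \<le> vnorm X y + vnorm X (y \<ominus> x)"
proof -
  have "y \<oplus> (x \<ominus> y) = x"
    using assms by (simp add: a_minus_def M.a_ac M.r_neg M.r_neg1)
  then have "vnorm X x \<le> vnorm X y + vnorm X (x \<ominus> y)"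
    using vnorm_triangle[of y "x \<ominus> y"] assms by simp
  then show ?thesis
    using vnorm_diff_commute assms by simp
qed

lemma normalize_in_unit_sphere:
  assumes "x \<in> carrier X" "x \<noteq> \<zero>"
  shows "complex_of_real (inverse (vnorm X x)) \<odot> x \<in> unit_sphere X"
proof -
  have "vnorm X x > 0"
    using assms vnorm_nonneg[of x] vnorm_eq_zero[of x] by linarith
  then show ?thesis
    using assms vnorm_smult[OF of_real_in_scalars, of x "inverse (vnorm X x)"]
    by (simp add: unit_sphere_def del: of_real_inverse)
qed

lemma limitin_norm_topology:
  assumes "l \<in> carrier X" "\<And>n. s n \<in> carrier X"
  shows "limitin (norm_topology X) s l sequentially \<longleftrightarrow>
    (\<lambda>n. vnorm X (s n \<ominus> l)) \<longlonglongrightarrow> 0"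
  using assms
  by (simp add: norm_topology_def Metric_space.limitin_metric_dist_null[OF Metric_space_ndist]
      ndist_def)

lemma bounded_op_bound:
  assumes "normed_space K Y" "T \<in> bounded_ops K X Y"
  obtains C where "C \<ge> 0" "\<And>x. x \<in> carrier X \<Longrightarrow> vnorm Y (T x) \<le> C * vnorm X x"
proof -
  obtain C where C: "\<And>x. x \<in> carrier X \<Longrightarrow> vnorm Y (T x) \<le> C * vnorm X x"
    using assms unfolding bounded_ops_def by blast
  show thesis
  proof (rule that[of "max C 0"])
    fix x assume x: "x \<in> carrier X"
    show "vnorm Y (T x) \<le> max C 0 * vnorm X x"
      by (rule order_trans[OF C[OF x]]) (simp add: mult_right_mono vnorm_nonneg x)
  qed simp
qed

lemma vnorm_le_op_norm:
  assumes Y: "normed_space K Y" and T: "T \<in> bounded_ops K X Y" and x: "x \<in> carrier X"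
  shows "vnorm Y (T x) \<le> op_norm X Y T * vnorm X x"
proof -
  interpret Y: normed_space K Y by (fact Y)
  obtain C where C: "C \<ge> 0" "\<And>x. x \<in> carrier X \<Longrightarrow> vnorm Y (T x) \<le> C * vnorm X x"
    using bounded_op_bound[OF Y T] by blast
  have Tc: "\<And>x. x \<in> carrier X \<Longrightarrow> T x \<in> carrier Y"
    and Ts: "\<And>a x. a \<in> K \<Longrightarrow> x \<in> carrier X \<Longrightarrow> T (a \<odot> x) = a \<odot>\<^bsub>Y\<^esub> T x"
    using T unfolding bounded_ops_def by auto
  have bdd: "bdd_above ((\<lambda>x. vnorm Y (T x)) ` unit_ball X)"
  proof (rule bdd_aboveI2)
    fix u assume "u \<in> unit_ball X"
    then show "vnorm Y (T u) \<le> C"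
      using C(2)[of u] mult_left_le[OF _ C(1), of "vnorm X u"] by (simp add: unit_ball_def)
  qed
  show ?thesis
  proof (cases "x = \<zero>")
    case True
    then show ?thesis using C(2)[of \<zero>] by simp
  next
    case False
    let ?r = "inverse (vnorm X x)"
    have pos: "vnorm X x > 0"
      using x False vnorm_nonneg[of x] vnorm_eq_zero[of x] by linarith
    have "complex_of_real ?r \<odot> x \<in> unit_ball X"
      using normalize_in_unit_sphere[OF x False] by (simp add: unit_sphere_def unit_ball_def)
    then have "vnorm Y (T (complex_of_real ?r \<odot> x)) \<le> op_norm X Y T"
      unfolding op_norm_def by (rule cSUP_upper[OF _ bdd])
    then have "?r * vnorm Y (T x) \<le> op_norm X Y T"
      using Ts[OF of_real_in_scalars x, of ?r]
        Y.vnorm_smult[OF Y.of_real_in_scalars Tc[OF x], of ?r] pos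
      by (simp del: of_real_inverse)
    then show ?thesis using pos by (simp add: field_simps)
  qed
qed

lemma id_bounded_op: "(\<lambda>x. x) \<in> bounded_ops K X X"
  unfolding bounded_ops_def by (auto intro: exI[of _ 1])

lemma op_norm_id:
  assumes "x \<in> unit_sphere X"
  shows "op_norm X X (\<lambda>x. x) = 1"
proof -
  have x: "x \<in> unit_ball X" "vnorm X x = 1"
    using assms by (auto simp: unit_sphere_def unit_ball_def)
  have "(SUP x\<in>unit_ball X. vnorm X x) = 1"
  proof (rule cSup_eq_maximum)
    show "1 \<in> vnorm X ` unit_ball X" using x by (metis image_eqI)
  qed (auto simp: unit_ball_def)
  then show ?thesis by (simp add: op_norm_def)
qed

lemma diff_bounded_op:
  assumes Y: "normed_space K Y" and S: "S \<in> bounded_ops K X Y" and T: "T \<in> bounded_ops K X Y"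
  shows "(\<lambda>x. S x \<ominus>\<^bsub>Y\<^esub> T x) \<in> bounded_ops K X Y"
proof -
  interpret Y: normed_space K Y by (fact Y)
  obtain A where A: "A \<ge> 0" "\<And>x. x \<in> carrier X \<Longrightarrow> vnorm Y (S x) \<le> A * vnorm X x"
    using bounded_op_bound[OF Y S] by blast
  obtain B where B: "B \<ge> 0" "\<And>x. x \<in> carrier X \<Longrightarrow> vnorm Y (T x) \<le> B * vnorm X x"
    using bounded_op_bound[OF Y T] by blast
  have c: "\<And>x. x \<in> carrier X \<Longrightarrow> S x \<in> carrier Y" "\<And>x. x \<in> carrier X \<Longrightarrow> T x \<in> carrier Y"
    using S T unfolding bounded_ops_def by auto
  have "vnorm Y (S x \<ominus>\<^bsub>Y\<^esub> T x) \<le> (A + B) * vnorm X x" if "x \<in> carrier X" for x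
    using Y.vnorm_diff_le[OF c[OF that]] A(2)[OF that] B(2)[OF that] by (simp add: distrib_right)
  then show ?thesis
    using S T c unfolding bounded_ops_def
    by (auto simp: Y.add_diff_add Y.scale_diff_right intro!: exI[of _ "A + B"])
qed

text \<open>Half of the perturbation theory of the identity: an operator at distance less than one
  from it is an isomorphism onto its range, so that convergence of images can be pulled back.\<close>

lemma bounded_below_near_id:
  assumes S: "S \<in> bounded_ops K X X" and x: "x \<in> carrier X"
  shows "(1 - op_norm X X (\<lambda>u. S u \<ominus> u)) * vnorm X x \<le> vnorm X (S x)"
proof -
  have Sx: "S x \<in> carrier X" using S x unfolding bounded_ops_def by auto
  have "vnorm X (S x \<ominus> x) \<le> op_norm X X (\<lambda>u. S u \<ominus> u) * vnorm X x"
    using vnorm_le_op_norm[OF normed_space_axioms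
        diff_bounded_op[OF normed_space_axioms S id_bounded_op] x] .
  then show ?thesis
    using vnorm_le_add_diff[OF x Sx] by (simp add: algebra_simps)
qed

end

section \<open>Norming functionals\<close>

context normed_space
begin

text \<open>The restriction to extensional functions makes the pointwise order on the carrier
  antisymmetric, as Zorn's lemma requires.\<close>

definition sublinear :: "('a \<Rightarrow> real) \<Rightarrow> bool" where
  "sublinear q \<longleftrightarrow> q \<in> extensional (carrier X)
    \<and> (\<forall>x\<in>carrier X. \<forall>y\<in>carrier X. q (x \<oplus> y) \<le> q x + q y)
    \<and> (\<forall>r\<ge>0. \<forall>x\<in>carrier X. q (complex_of_real r \<odot> x) = r * q x)"

text \<open>For the homogeneity of an infimum only the upper estimate for \<open>r > 0\<close> is easy; the
  lower one is the upper one for the factor \<open>1 / r\<close>.\<close>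

lemma sublinearI:
  assumes "q \<in> extensional (carrier X)"
    and "\<And>x y. x \<in> carrier X \<Longrightarrow> y \<in> carrier X \<Longrightarrow> q (x \<oplus> y) \<le> q x + q y"
    and le: "\<And>r x. r > 0 \<Longrightarrow> x \<in> carrier X \<Longrightarrow> q (complex_of_real r \<odot> x) \<le> r * q x"
    and zero: "q \<zero> = 0"
  shows "sublinear q"
proof -
  have "q (complex_of_real r \<odot> x) = r * q x" if "r \<ge> 0" "x \<in> carrier X" for r x
  proof (cases "r = 0")
    case True
    then show ?thesis using zero that by simp
  next
    case False
    then have r: "r > 0" using that by simp
    have "complex_of_real (1 / r) \<odot> (complex_of_real r \<odot> x) = x"
      using r that scale_scale[OF of_real_in_scalars of_real_in_scalars, of x "1 / r" r]
      by (simp flip: of_real_mult)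
    then have "q x \<le> 1 / r * q (complex_of_real r \<odot> x)"
      using le[of "1 / r" "complex_of_real r \<odot> x"] r that by simp
    then show ?thesis
      using le[OF r that(2)] r by (simp add: field_simps)
  qed
  then show ?thesis using assms unfolding sublinear_def by blast
qed

lemma sublinear_add: "sublinear q \<Longrightarrow> x \<in> carrier X \<Longrightarrow> y \<in> carrier X \<Longrightarrow> q (x \<oplus> y) \<le> q x + q y"
  and sublinear_scale: "sublinear q \<Longrightarrow> r \<ge> 0 \<Longrightarrow> x \<in> carrier X \<Longrightarrow>
    q (complex_of_real r \<odot> x) = r * q x"
  unfolding sublinear_def by blast+

lemma sublinear_zero: "sublinear q \<Longrightarrow> q \<zero> = 0"
  using sublinear_scale[of q 0 "\<zero>"] by simp

lemma sublinear_ge_minus: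
  assumes "sublinear q" "x \<in> carrier X"
  shows "- q (\<ominus> x) \<le> q x"
  using sublinear_add[OF assms(1), of x "\<ominus> x"] sublinear_zero[OF assms(1)] assms(2)
  by (simp add: M.r_neg)

lemma sublinear_norm: "sublinear (restrict (vnorm X) (carrier X))"
  by (rule sublinearI) (auto simp: vnorm_triangle vnorm_smult)

text \<open>The largest sublinear functional \<open>L\<close> below \<open>q\<close> with \<open>L (x \<oplus> z) = L x + q z\<close> for all \<open>x\<close>. It
  is strictly smaller than \<open>q\<close> somewhere unless \<open>q\<close> itself has this property, which is why minimal
  sublinear functionals are additive.\<close>

definition linearize_along :: "'a \<Rightarrow> ('a \<Rightarrow> real) \<Rightarrow> 'a \<Rightarrow> real" where
  "linearize_along z q =
    (\<lambda>x\<in>carrier X. INF t\<in>{0..}. q (x \<oplus> complex_of_real t \<odot> z) - t * q z)"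

lemma bdd_below_linearize_along:
  assumes q: "sublinear q" and x: "x \<in> carrier X" and z: "z \<in> carrier X"
  shows "bdd_below ((\<lambda>t. q (x \<oplus> complex_of_real t \<odot> z) - t * q z) ` {0..})"
proof (rule bdd_belowI2)
  fix t :: real assume "t \<in> {0..}"
  then have t: "t \<ge> 0" by simp
  have "\<ominus> x \<oplus> (x \<oplus> complex_of_real t \<odot> z) = complex_of_real t \<odot> z"
    using x z by (simp add: M.r_neg1)
  then have "t * q z \<le> q (\<ominus> x) + q (x \<oplus> complex_of_real t \<odot> z)"
    using sublinear_add[OF q, of "\<ominus> x" "x \<oplus> complex_of_real t \<odot> z"] sublinear_scale[OF q t z] x z
    by simp
  then show "- q (\<ominus> x) \<le> q (x \<oplus> complex_of_real t \<odot> z) - t * q z" by simp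
qed

lemma linearize_along_le:
  assumes "sublinear q" "x \<in> carrier X" "z \<in> carrier X" "t \<ge> 0"
  shows "linearize_along z q x \<le> q (x \<oplus> complex_of_real t \<odot> z) - t * q z"
  using cINF_lower[OF bdd_below_linearize_along[OF assms(1-3)], of t] assms
  by (simp add: linearize_along_def)

lemma le_linearize_along:
  assumes "x \<in> carrier X"
    and "\<And>t. t \<ge> 0 \<Longrightarrow> c \<le> q (x \<oplus> complex_of_real t \<odot> z) - t * q z"
  shows "c \<le> linearize_along z q x"
  using assms by (auto simp: linearize_along_def intro!: cINF_greatest)

lemma linearize_along_le_self:
  assumes "sublinear q" "x \<in> carrier X" "z \<in> carrier X"
  shows "linearize_along z q x \<le> q x"
  using linearize_along_le[OF assms, of 0] assms by simp

lemma sublinear_linearize_along: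
  assumes q: "sublinear q" and z: "z \<in> carrier X"
  shows "sublinear (linearize_along z q)"
proof (rule sublinearI)
  show "linearize_along z q \<in> extensional (carrier X)"
    by (simp add: linearize_along_def)
next
  fix x y assume x: "x \<in> carrier X" and y: "y \<in> carrier X"
  let ?L = "linearize_along z q"
  have *: "?L (x \<oplus> y) \<le>
      (q (x \<oplus> complex_of_real s \<odot> z) - s * q z) + (q (y \<oplus> complex_of_real t \<odot> z) - t * q z)"
    if s: "s \<ge> 0" and t: "t \<ge> 0" for s t
  proof -
    have "(x \<oplus> y) \<oplus> complex_of_real (s + t) \<odot> z =
        (x \<oplus> complex_of_real s \<odot> z) \<oplus> (y \<oplus> complex_of_real t \<odot> z)"
      using x y z by (simp add: scale_add_left M.a_ac)
    then have "q ((x \<oplus> y) \<oplus> complex_of_real (s + t) \<odot> z) \<le>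
        q (x \<oplus> complex_of_real s \<odot> z) + q (y \<oplus> complex_of_real t \<odot> z)"
      using sublinear_add[OF q, of "x \<oplus> complex_of_real s \<odot> z" "y \<oplus> complex_of_real t \<odot> z"] x y z
      by simp
    then show ?thesis
      using linearize_along_le[OF q _ z, of "x \<oplus> y" "s + t"] x y s t
      by (simp add: algebra_simps)
  qed
  have "?L (x \<oplus> y) - (q (y \<oplus> complex_of_real t \<odot> z) - t * q z) \<le> ?L x" if "t \<ge> 0" for t
    by (rule le_linearize_along[OF x]) (use *[OF _ that] in \<open>simp add: algebra_simps\<close>)
  then have "?L (x \<oplus> y) - ?L x \<le> ?L y"
    by (intro le_linearize_along[OF y]) (simp add: algebra_simps)
  then show "?L (x \<oplus> y) \<le> ?L x + ?L y" by simp
next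
  fix r :: real and x assume r: "r > 0" and x: "x \<in> carrier X"
  let ?L = "linearize_along z q"
  have "?L (complex_of_real r \<odot> x) / r \<le> ?L x"
  proof (rule le_linearize_along[OF x])
    fix t :: real assume t: "t \<ge> 0"
    have "complex_of_real r \<odot> x \<oplus> complex_of_real (r * t) \<odot> z =
        complex_of_real r \<odot> (x \<oplus> complex_of_real t \<odot> z)"
      using x z by (simp add: scale_add_right scale_scale)
    then have "q (complex_of_real r \<odot> x \<oplus> complex_of_real (r * t) \<odot> z) =
        r * q (x \<oplus> complex_of_real t \<odot> z)"
      using sublinear_scale[OF q, of r "x \<oplus> complex_of_real t \<odot> z"] r x z by simp
    then show "?L (complex_of_real r \<odot> x) / r \<le> q (x \<oplus> complex_of_real t \<odot> z) - t * q z"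
      using linearize_along_le[OF q _ z, of "complex_of_real r \<odot> x" "r * t"] r t x
      by (simp add: field_simps)
  qed
  then show "?L (complex_of_real r \<odot> x) \<le> r * ?L x" using r by (simp add: field_simps)
next
  have "0 \<le> linearize_along z q \<zero>"
    by (rule le_linearize_along) (simp_all add: sublinear_scale[OF q _ z] z)
  then show "linearize_along z q \<zero> = 0"
    using linearize_along_le_self[OF q _ z, of \<zero>] sublinear_zero[OF q] by simp
qed

text \<open>All members of the chain stay above \<open>- p (\<ominus> x)\<close>, so their infimum is finite, and any two
  of them lie above a common member, which makes the infimum subadditive.\<close>

lemma sublinear_INF_chain:
  assumes p: "sublinear p" and ne: "C \<noteq> {}"
    and C: "\<And>q. q \<in> C \<Longrightarrow> sublinear q" "\<And>q x. q \<in> C \<Longrightarrow> x \<in> carrier X \<Longrightarrow> q x \<le> p x"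
    and chain: "\<And>q q'. q \<in> C \<Longrightarrow> q' \<in> C \<Longrightarrow>
      (\<forall>x\<in>carrier X. q x \<le> q' x) \<or> (\<forall>x\<in>carrier X. q' x \<le> q x)"
  shows "sublinear (\<lambda>x\<in>carrier X. INF q\<in>C. q x)" (is "sublinear ?m")
    and "\<And>q x. q \<in> C \<Longrightarrow> x \<in> carrier X \<Longrightarrow> (\<lambda>x\<in>carrier X. INF q\<in>C. q x) x \<le> q x"
proof -
  have bdd: "bdd_below ((\<lambda>q. q x) ` C)" if x: "x \<in> carrier X" for x
  proof (rule bdd_belowI2)
    fix q assume "q \<in> C"
    then show "- p (\<ominus> x) \<le> q x"
      using sublinear_ge_minus[OF C(1) x, of q] C(2)[of q "\<ominus> x"] x by force
  qed
  show le: "?m x \<le> q x" if "q \<in> C" "x \<in> carrier X" for q x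
    using cINF_lower[OF bdd that(1)] that by simp
  have ge: "c \<le> ?m x" if "x \<in> carrier X" "\<And>q. q \<in> C \<Longrightarrow> c \<le> q x" for c x
    using that ne by (auto intro!: cINF_greatest)
  show "sublinear ?m"
  proof (rule sublinearI)
    fix x y assume x: "x \<in> carrier X" and y: "y \<in> carrier X"
    have *: "?m (x \<oplus> y) \<le> q x + q' y" if q: "q \<in> C" "q' \<in> C" for q q'
    proof -
      obtain r where r: "r \<in> C" "r x \<le> q x" "r y \<le> q' y"
        using chain[OF q] q x y by blast
      then show ?thesis
        using le[OF r(1), of "x \<oplus> y"] sublinear_add[OF C(1)[OF r(1)] x y] x y by simp
    qed
    have "?m (x \<oplus> y) - q' y \<le> ?m x" if "q' \<in> C" for q'
      by (rule ge[OF x]) (use *[OF _ that] in \<open>simp add: algebra_simps\<close>)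
    then have "?m (x \<oplus> y) - ?m x \<le> ?m y"
      by (intro ge[OF y]) (simp add: algebra_simps)
    then show "?m (x \<oplus> y) \<le> ?m x + ?m y" by simp
  next
    fix r :: real and x assume r: "r > 0" and x: "x \<in> carrier X"
    have "?m (complex_of_real r \<odot> x) / r \<le> ?m x"
    proof (rule ge[OF x])
      fix q assume q: "q \<in> C"
      show "?m (complex_of_real r \<odot> x) / r \<le> q x"
        using le[OF q, of "complex_of_real r \<odot> x"] sublinear_scale[OF C(1)[OF q], of r x] r x
        by (simp add: field_simps)
    qed
    then show "?m (complex_of_real r \<odot> x) \<le> r * ?m x" using r by (simp add: field_simps)
  next
    show "?m \<zero> = 0"
      using ne by (simp add: sublinear_zero[OF C(1)])
  qed simp
qed

text \<open>Zorn's lemma produces maximal elements, so it is applied to the reversed pointwise order.\<close>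

lemma exists_minimal_sublinear:
  assumes p: "sublinear p"
  obtains q where "sublinear q" "\<And>x. x \<in> carrier X \<Longrightarrow> q x \<le> p x"
    "\<And>q'. sublinear q' \<Longrightarrow> (\<And>x. x \<in> carrier X \<Longrightarrow> q' x \<le> q x) \<Longrightarrow> q' = q"
proof -
  define A where "A = {q. sublinear q \<and> (\<forall>x\<in>carrier X. q x \<le> p x)}"
  define P where "P q q' \<longleftrightarrow> (\<forall>x\<in>carrier X. q' x \<le> q x)" for q q' :: "'a \<Rightarrow> real"
  have "\<exists>m\<in>A. \<forall>a\<in>A. P m a \<longrightarrow> a = m"
  proof (rule predicate_Zorn)
    have "q = q'" if "q \<in> A" "q' \<in> A" "P q q'" "P q' q" for q q'
    proof (rule extensionalityI[of _ "carrier X"])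
      show "q \<in> extensional (carrier X)" "q' \<in> extensional (carrier X)"
        using that by (auto simp: A_def sublinear_def)
      show "q x = q' x" if "x \<in> carrier X" for x
        using \<open>P q q'\<close> \<open>P q' q\<close> that unfolding P_def by (meson antisym)
    qed
    then show "partial_order_on A (relation_of P A)"
      by (intro partial_order_on_relation_ofI) (auto simp: P_def intro: order_trans)
  next
    fix C assume C: "C \<in> Chains (relation_of P A)"
    show "\<exists>u\<in>A. \<forall>a\<in>C. P a u"
    proof (cases "C = {}")
      case True
      then show ?thesis using p by (auto simp: A_def)
    next
      case False
      have CA: "q \<in> A" if "q \<in> C" for q
        using C that by (auto simp: Chains_def relation_of_def)
      have ch: "(\<forall>x\<in>carrier X. q x \<le> q' x) \<or> (\<forall>x\<in>carrier X. q' x \<le> q x)"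
        if "q \<in> C" "q' \<in> C" for q q'
        using C that by (auto simp: Chains_def relation_of_def P_def)
      let ?m = "\<lambda>x\<in>carrier X. INF q\<in>C. q x"
      have C_sub: "sublinear q" and C_le: "x \<in> carrier X \<Longrightarrow> q x \<le> p x" if "q \<in> C" for q x
        using CA[OF that] by (auto simp: A_def)
      have m: "sublinear ?m" "\<And>q x. q \<in> C \<Longrightarrow> x \<in> carrier X \<Longrightarrow> ?m x \<le> q x"
        by (rule sublinear_INF_chain[OF p False]; use C_sub C_le ch in blast)+
      obtain q0 where "q0 \<in> C" using False by blast
      then have "?m x \<le> p x" if "x \<in> carrier X" for x
        using m(2)[OF \<open>q0 \<in> C\<close> that] C_le[OF \<open>q0 \<in> C\<close> that] by linarith
      then have "?m \<in> A" using m(1) by (simp add: A_def)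
      moreover have "\<forall>a\<in>C. P a ?m" using m(2) by (simp add: P_def)
      ultimately show ?thesis by blast
    qed
  qed
  then obtain q where q: "q \<in> A" "\<And>a. a \<in> A \<Longrightarrow> P q a \<Longrightarrow> a = q" by blast
  show thesis
  proof (rule that[of q])
    show "sublinear q" "\<And>x. x \<in> carrier X \<Longrightarrow> q x \<le> p x" using q by (auto simp: A_def)
    show "q' = q" if "sublinear q'" "\<And>x. x \<in> carrier X \<Longrightarrow> q' x \<le> q x" for q'
      using q that by (fastforce simp: A_def P_def)
  qed
qed

lemma exists_real_linear_below:
  assumes p: "sublinear p"
  obtains q where "\<And>x. x \<in> carrier X \<Longrightarrow> q x \<le> p x"
    "\<And>x y. x \<in> carrier X \<Longrightarrow> y \<in> carrier X \<Longrightarrow> q (x \<oplus> y) = q x + q y"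
    "\<And>r x. x \<in> carrier X \<Longrightarrow> q (complex_of_real r \<odot> x) = r * q x"
proof -
  obtain q where q: "sublinear q" "\<And>x. x \<in> carrier X \<Longrightarrow> q x \<le> p x"
    and min: "\<And>q'. sublinear q' \<Longrightarrow> (\<And>x. x \<in> carrier X \<Longrightarrow> q' x \<le> q x) \<Longrightarrow> q' = q"
    using exists_minimal_sublinear[OF p] by metis
  have add: "q (x \<oplus> y) = q x + q y" if x: "x \<in> carrier X" and y: "y \<in> carrier X" for x y
  proof -
    have "linearize_along y q = q"
      by (rule min) (use sublinear_linearize_along linearize_along_le_self q y in auto)
    then have "q x \<le> q (x \<oplus> y) - q y"
      using linearize_along_le[OF q(1) x y, of 1] y by simp
    then show ?thesis using sublinear_add[OF q(1) x y] by simp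
  qed
  have "q (complex_of_real r \<odot> x) = r * q x" if x: "x \<in> carrier X" for r x
  proof (cases "r \<ge> 0")
    case True
    then show ?thesis using sublinear_scale[OF q(1) _ x] by simp
  next
    case False
    have "q (complex_of_real r \<odot> x \<oplus> complex_of_real (- r) \<odot> x) = 0"
      using scale_add_left[OF of_real_in_scalars of_real_in_scalars x, of r "- r"] x
        sublinear_zero[OF q(1)] by simp
    then have "q (complex_of_real r \<odot> x) + (- r) * q x = 0"
      using add[of "complex_of_real r \<odot> x" "complex_of_real (- r) \<odot> x"]
        sublinear_scale[OF q(1) _ x, of "- r"] False x
      by (simp del: of_real_minus)
    then show ?thesis by simp
  qed
  then show thesis using that q(2) add by blast
qed

lemma in_dual_iff:
  "f \<in> dual K X \<longleftrightarrow> f \<in> carrier X \<rightarrow> K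
     \<and> (\<forall>x\<in>carrier X. \<forall>y\<in>carrier X. f (x \<oplus> y) = f x + f y)
     \<and> (\<forall>a\<in>K. \<forall>x\<in>carrier X. f (a \<odot> x) = a * f x)
     \<and> (\<exists>C. \<forall>x\<in>carrier X. cmod (f x) \<le> C * vnorm X x)"
  by (simp add: dual_def bounded_ops_def scalar_space_def)

text \<open>The classical recipe: a \<open>K\<close>-linear functional is determined by its real part \<open>q\<close>, which
  over the complex numbers may be any real-linear \<open>q\<close>. Rotating \<open>x\<close> so that \<open>f x\<close> becomes
  nonnegative bounds the modulus by the bound for the real part.\<close>

lemma exists_dual_with_real_part:
  assumes le: "\<And>x. x \<in> carrier X \<Longrightarrow> q x \<le> vnorm X x"
    and add: "\<And>x y. x \<in> carrier X \<Longrightarrow> y \<in> carrier X \<Longrightarrow> q (x \<oplus> y) = q x + q y"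
    and scale: "\<And>r x. x \<in> carrier X \<Longrightarrow> q (complex_of_real r \<odot> x) = r * q x"
  obtains f where "f \<in> dual K X" "\<And>x. x \<in> carrier X \<Longrightarrow> Re (f x) = q x"
    "\<And>x. x \<in> carrier X \<Longrightarrow> cmod (f x) \<le> vnorm X x"
proof -
  have "\<exists>f. f \<in> carrier X \<rightarrow> K
     \<and> (\<forall>x\<in>carrier X. \<forall>y\<in>carrier X. f (x \<oplus> y) = f x + f y)
     \<and> (\<forall>a\<in>K. \<forall>x\<in>carrier X. f (a \<odot> x) = a * f x)
     \<and> (\<forall>x\<in>carrier X. Re (f x) = q x)"
    using scalars
  proof
    assume K: "K = \<real>"
    show ?thesis
      by (rule exI[of _ "\<lambda>x. complex_of_real (q x)"])
        (auto simp: K add scale elim!: Reals_cases)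
  next
    assume K: "K = UNIV"
    define f where "f x = Complex (q x) (- q (\<i> \<odot> x))" for x
    have iK: "a \<in> K" for a using K by simp
    have f_add: "f (x \<oplus> y) = f x + f y" if "x \<in> carrier X" "y \<in> carrier X" for x y
      using that by (simp add: f_def add iK scale_add_right complex_eq_iff)
    have "f (a \<odot> x) = a * f x" if x: "x \<in> carrier X" for a x
    proof -
      have "a = complex_of_real (Re a) + complex_of_real (Im a) * \<i>"
        by (simp add: complex_eq_iff)
      then have "a \<odot> x = complex_of_real (Re a) \<odot> x \<oplus> complex_of_real (Im a) \<odot> (\<i> \<odot> x)"
        using x by (metis iK scale_add_left scale_scale)
      then have 1: "q (a \<odot> x) = Re a * q x + Im a * q (\<i> \<odot> x)"
        using x by (simp add: add scale iK)
      have "\<i> * a = complex_of_real (Re a) * \<i> + complex_of_real (- Im a)"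
        by (simp add: complex_eq_iff)
      then have "\<i> \<odot> (a \<odot> x) =
          complex_of_real (Re a) \<odot> (\<i> \<odot> x) \<oplus> complex_of_real (- Im a) \<odot> x"
        using x by (metis iK scale_add_left scale_scale)
      then have 2: "q (\<i> \<odot> (a \<odot> x)) = Re a * q (\<i> \<odot> x) - Im a * q x"
        using x by (simp add: add scale iK del: of_real_minus)
      show ?thesis by (simp add: f_def 1 2 complex_eq_iff)
    qed
    then show ?thesis
      using f_add by (intro exI[of _ f]) (auto simp: f_def K)
  qed
  then obtain f where f: "f \<in> carrier X \<rightarrow> K"
    "\<forall>x\<in>carrier X. \<forall>y\<in>carrier X. f (x \<oplus> y) = f x + f y"
    "\<And>a x. a \<in> K \<Longrightarrow> x \<in> carrier X \<Longrightarrow> f (a \<odot> x) = a * f x"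
    "\<And>x. x \<in> carrier X \<Longrightarrow> Re (f x) = q x"
    by blast
  have bound: "cmod (f x) \<le> vnorm X x" if x: "x \<in> carrier X" for x
  proof (cases "f x = 0")
    case True
    then show ?thesis using vnorm_nonneg[OF x] by simp
  next
    case False
    define c where "c = cnj (sgn (f x))"
    have "f x \<in> K" using f(1) x by blast
    then have c: "c \<in> K"
      using scalars by (auto simp: c_def sgn_eq elim!: Reals_cases simp flip: of_real_divide)
    have "c * f x = complex_of_real (cmod (f x))"
      using False
      by (simp add: c_def sgn_eq complex_norm_square[symmetric] power2_eq_square mult.commute)
    then have "cmod (f x) = q (c \<odot> x)"
      using f(3)[OF c x] f(4)[of "c \<odot> x"] c x by simp
    also have "\<dots> \<le> vnorm X (c \<odot> x)" using le c x by simp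
    also have "\<dots> = vnorm X x"
      using False vnorm_smult[OF c x] by (simp add: c_def norm_sgn)
    finally show ?thesis .
  qed
  then have "f \<in> dual K X"
    using f by (auto simp: in_dual_iff intro!: exI[of _ 1])
  then show thesis using that f(4) bound by blast
qed

text \<open>The Hahn--Banach theorem in the form used below. Linearizing the norm along \<open>y\<close>
  first lowers its value at \<open>\<ominus> y\<close> to minus the norm of \<open>y\<close>, so a real-linear functional below the
  result is at least the norm of \<open>y\<close> at \<open>y\<close>.\<close>

theorem exists_norming_functional:
  assumes y: "y \<in> carrier X"
  obtains f where "f \<in> dual K X" "f y = complex_of_real (vnorm X y)"
    "\<And>x. x \<in> carrier X \<Longrightarrow> cmod (f x) \<le> vnorm X x"
proof -
  let ?N = "restrict (vnorm X) (carrier X)"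
  have my: "\<ominus> y \<in> carrier X" using y by simp
  obtain q where le: "\<And>x. x \<in> carrier X \<Longrightarrow> q x \<le> linearize_along y ?N x"
    and add: "\<And>x y. x \<in> carrier X \<Longrightarrow> y \<in> carrier X \<Longrightarrow> q (x \<oplus> y) = q x + q y"
    and scale: "\<And>r x. x \<in> carrier X \<Longrightarrow> q (complex_of_real r \<odot> x) = r * q x"
    using exists_real_linear_below[OF sublinear_linearize_along[OF sublinear_norm y]] by metis
  have le_norm: "q x \<le> vnorm X x" if "x \<in> carrier X" for x
    using le[OF that] linearize_along_le_self[OF sublinear_norm that y] that by simp
  have "q (\<ominus> y) \<le> - vnorm X y"
    using le[OF my] linearize_along_le[OF sublinear_norm my y, of 1] y by (simp add: M.l_neg)
  moreover have "q (\<ominus> y) = - q y"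
    using scale[OF y, of "- 1"] y by (simp add: minus_eq_smult)
  ultimately have qy: "q y = vnorm X y" using le_norm[OF y] by simp
  obtain f where f: "f \<in> dual K X" "\<And>x. x \<in> carrier X \<Longrightarrow> Re (f x) = q x"
    "\<And>x. x \<in> carrier X \<Longrightarrow> cmod (f x) \<le> vnorm X x"
    using exists_dual_with_real_part[OF le_norm add scale] by metis
  \<comment> \<open>A complex number whose modulus does not exceed its real part is that real part.\<close>
  have "Re (f y) = vnorm X y" "cmod (f y) \<le> vnorm X y" using f(2,3) y qy by auto
  then have "(Im (f y))\<^sup>2 \<le> 0"
    using power_mono[of "cmod (f y)" "vnorm X y" 2] by (simp add: cmod_power2)
  then have "f y = complex_of_real (vnorm X y)"
    using \<open>Re (f y) = vnorm X y\<close> by (simp add: complex_eq_iff)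
  then show thesis using that f by blast
qed

end

section \<open>Strongly exposed points from range strongly exposing operators\<close>

context normed_space
begin

text \<open>An exposing functional has positive real part at the exposed point, and this would increase
  further if the point were in the interior of the ball and were rescaled to the sphere.\<close>

lemma strongly_exposed_points_subset_sphere: "strongly_exposed_points K X \<subseteq> unit_sphere X"
proof
  fix x0 assume "x0 \<in> strongly_exposed_points K X"
  then obtain f where x0: "x0 \<in> carrier X" "vnorm X x0 \<le> 1" and fd: "f \<in> dual K X"
    and nz: "\<exists>x\<in>carrier X. f x \<noteq> 0" and sup: "Re (f x0) = (SUP x\<in>unit_ball X. Re (f x))"
    by (auto simp: strongly_exposed_points_def unit_ball_def)
  obtain C where C: "C \<ge> 0" "\<And>x. x \<in> carrier X \<Longrightarrow> cmod (f x) \<le> C * vnorm X x"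
    using bounded_op_bound[OF normed_space_scalar_space[OF scalars] fd[unfolded dual_def]]
    by (auto simp: scalar_space_def)
  have fs: "\<And>a x. a \<in> K \<Longrightarrow> x \<in> carrier X \<Longrightarrow> f (a \<odot> x) = a * f x"
    and fK: "\<And>x. x \<in> carrier X \<Longrightarrow> f x \<in> K"
    using fd by (auto simp: in_dual_iff)
  have bdd: "bdd_above ((\<lambda>x. Re (f x)) ` unit_ball X)"
  proof (rule bdd_aboveI2)
    fix x assume "x \<in> unit_ball X"
    then show "Re (f x) \<le> C"
      using C(2)[of x] mult_left_le[OF _ C(1), of "vnorm X x"] complex_Re_le_cmod[of "f x"]
      by (simp add: unit_ball_def)
  qed
  have f_max: "Re (f x) \<le> Re (f x0)" if "x \<in> unit_ball X" for x
    unfolding sup by (rule cSUP_upper[OF that bdd])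
  obtain u where u: "u \<in> carrier X" "f u \<noteq> 0" using nz by blast
  define a where "a = cnj (f u)"
  have a: "a \<in> K" using fK[OF u(1)] scalars by (auto simp: a_def elim!: Reals_cases)
  define v where "v = a \<odot> u"
  have v: "v \<in> carrier X" using a u by (simp add: v_def)
  have "f v = complex_of_real ((cmod (f u))\<^sup>2)"
    using fs[OF a u(1)] by (simp add: v_def a_def complex_norm_square[symmetric] mult.commute)
  then have fv: "Re (f v) > 0" using u by simp
  then have "v \<noteq> \<zero>" using fs[of 0 v] v by auto
  have pos: "Re (f x0) > 0"
  proof -
    have "vnorm X v > 0"
      using v \<open>v \<noteq> \<zero>\<close> vnorm_nonneg[of v] vnorm_eq_zero[of v] by linarith
    then have "Re (f (complex_of_real (inverse (vnorm X v)) \<odot> v)) > 0"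
      using fs[OF of_real_in_scalars v] fv by (simp del: of_real_inverse)
    then show ?thesis
      using f_max normalize_in_unit_sphere[OF v \<open>v \<noteq> \<zero>\<close>]
      by (force simp: unit_sphere_def unit_ball_def)
  qed
  then have "x0 \<noteq> \<zero>" using fs[of 0 x0] x0 by auto
  then have n0: "vnorm X x0 > 0"
    using x0 vnorm_nonneg[of x0] vnorm_eq_zero[of x0] by linarith
  have "Re (f (complex_of_real (inverse (vnorm X x0)) \<odot> x0)) \<le> Re (f x0)"
    using f_max normalize_in_unit_sphere[OF x0(1) \<open>x0 \<noteq> \<zero>\<close>]
    by (simp add: unit_sphere_def unit_ball_def)
  then have "inverse (vnorm X x0) * Re (f x0) \<le> Re (f x0)"
    using fs[OF of_real_in_scalars x0(1)] by (simp del: of_real_inverse)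
  then have "1 \<le> vnorm X x0"
    using pos n0 by (simp add: field_simps)
  then show "x0 \<in> unit_sphere X" using x0 by (simp add: unit_sphere_def)
qed

lemma limitin_of_subsequences:
  assumes "l \<in> carrier X" "\<And>n. s n \<in> carrier X"
    and sub: "\<And>r :: nat \<Rightarrow> nat. strict_mono r \<Longrightarrow>
      \<exists>t :: nat \<Rightarrow> nat. (\<lambda>n. vnorm X (s (r (t n)) \<ominus> l)) \<longlonglongrightarrow> 0"
  shows "limitin (norm_topology X) s l sequentially"
proof (rule ccontr)
  assume "\<not> ?thesis"
  then have "\<not> (\<lambda>n. vnorm X (s n \<ominus> l)) \<longlonglongrightarrow> 0"
    using assms by (simp add: limitin_norm_topology)
  then obtain e where e: "e > 0" "\<not> eventually (\<lambda>n. dist (vnorm X (s n \<ominus> l)) 0 < e) sequentially"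
    by (auto simp: tendsto_iff)
  then obtain r :: "nat \<Rightarrow> nat" where r: "strict_mono r"
    "\<And>n. \<not> dist (vnorm X (s (r n) \<ominus> l)) 0 < e"
    using not_eventually_sequentiallyD[OF e(2)] by blast
  obtain t :: "nat \<Rightarrow> nat" where "(\<lambda>n. vnorm X (s (r (t n)) \<ominus> l)) \<longlonglongrightarrow> 0"
    using sub[OF r(1)] by blast
  then have "eventually (\<lambda>n. dist (vnorm X (s (r (t n)) \<ominus> l)) 0 < e) sequentially"
    using e(1) by (simp add: tendsto_iff)
  then show False using r(2) by (auto simp: eventually_sequentially)
qed

text \<open>Let \<open>g\<close> norm \<open>S x0\<close> and expose with \<open>f = g \<circ> S\<close>. A sequence in the ball on which the real
  part of \<open>f\<close> tends to \<open>1\<close> is maximizing for \<open>S\<close>, so along a subsequence its image tends to a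
  rotation \<open>c \<odot> S z\<close>; since \<open>S\<close> is bounded below, the subsequence itself tends to \<open>c \<odot> z\<close>. The same
  reasoning for the constant sequence \<open>x0\<close> shows that \<open>x0\<close> is a rotation of \<open>z\<close>. So the limit
  is a rotation of \<open>x0\<close>, and \<open>f\<close> takes the value \<open>1\<close> at only one of these.\<close>

lemma strongly_exposed_point_if_RSE_bounded_below:
  assumes S: "S \<in> RSE K X X" and norm_S: "op_norm X X S = 1"
    and x0: "x0 \<in> unit_sphere X" and Sx0: "vnorm X (S x0) = 1"
    and d: "d > 0" and below: "\<And>x. x \<in> carrier X \<Longrightarrow> d * vnorm X x \<le> vnorm X (S x)"
  shows "x0 \<in> strongly_exposed_points K X"
proof -
  have Sop: "S \<in> bounded_ops K X X" using S by (simp add: RSE_def)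
  have Sc [simp]: "\<And>x. x \<in> carrier X \<Longrightarrow> S x \<in> carrier X"
    and Sadd: "\<And>x y. x \<in> carrier X \<Longrightarrow> y \<in> carrier X \<Longrightarrow> S (x \<oplus> y) = S x \<oplus> S y"
    and Ss: "\<And>a x. a \<in> K \<Longrightarrow> x \<in> carrier X \<Longrightarrow> S (a \<odot> x) = a \<odot> S x"
    using Sop unfolding bounded_ops_def by auto
  have S_le: "vnorm X (S x) \<le> vnorm X x" if "x \<in> carrier X" for x
    using vnorm_le_op_norm[OF normed_space_axioms Sop that] norm_S by simp
  have Sdiff: "S (x \<ominus> y) = S x \<ominus> S y" if "x \<in> carrier X" "y \<in> carrier X" for x y
    using that by (simp add: a_minus_def Sadd minus_eq_smult Ss)
  have x0c [simp]: "x0 \<in> carrier X" and nx0: "vnorm X x0 = 1" and x0b: "x0 \<in> unit_ball X"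
    using x0 by (auto simp: unit_sphere_def unit_ball_def)
  obtain z where z: "z \<in> unit_sphere X" and conv: "\<And>x :: nat \<Rightarrow> 'a.
      range x \<subseteq> unit_ball X \<Longrightarrow> (\<lambda>n. vnorm X (S (x n))) \<longlonglongrightarrow> 1 \<Longrightarrow>
      \<exists>t :: nat \<Rightarrow> nat. \<exists>c\<in>K. strict_mono t \<and> cmod c = 1
        \<and> limitin (norm_topology X) (\<lambda>n. S (x (t n))) (c \<odot> S z) sequentially"
    using S norm_S unfolding RSE_def by fastforce
  have zc [simp]: "z \<in> carrier X" using z by (simp add: unit_sphere_def)
  have pull_back: "\<exists>t :: nat \<Rightarrow> nat. \<exists>c\<in>K. strict_mono t \<and> cmod c = 1
        \<and> (\<lambda>n. vnorm X (x (t n) \<ominus> c \<odot> z)) \<longlonglongrightarrow> 0"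
    if x: "range x \<subseteq> unit_ball X" and lim: "(\<lambda>n. vnorm X (S (x n))) \<longlonglongrightarrow> 1" for x :: "nat \<Rightarrow> 'a"
  proof -
    obtain t :: "nat \<Rightarrow> nat" and c where t: "strict_mono t" and c: "c \<in> K" "cmod c = 1"
      and l: "limitin (norm_topology X) (\<lambda>n. S (x (t n))) (c \<odot> S z) sequentially"
      using conv[OF x lim] by blast
    have xc: "x n \<in> carrier X" for n using x by (auto simp: unit_ball_def)
    have "(\<lambda>n. vnorm X (S (x (t n)) \<ominus> c \<odot> S z)) \<longlonglongrightarrow> 0"
      using l limitin_norm_topology[of "c \<odot> S z" "\<lambda>n. S (x (t n))"] xc c by simp
    then have "(\<lambda>n. vnorm X (S (x (t n) \<ominus> c \<odot> z)) / d) \<longlonglongrightarrow> 0"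
      using xc c by (simp add: Sdiff Ss tendsto_divide_zero)
    then have "(\<lambda>n. vnorm X (x (t n) \<ominus> c \<odot> z)) \<longlonglongrightarrow> 0"
    proof (rule real_tendsto_sandwich[OF _ _ tendsto_const, rotated 2])
      show "\<forall>\<^sub>F n in sequentially. 0 \<le> vnorm X (x (t n) \<ominus> c \<odot> z)"
        using xc c by (simp add: vnorm_nonneg)
      show "\<forall>\<^sub>F n in sequentially.
          vnorm X (x (t n) \<ominus> c \<odot> z) \<le> vnorm X (S (x (t n) \<ominus> c \<odot> z)) / d"
        using below xc c d by (simp add: field_simps)
    qed
    then show ?thesis using t c by blast
  qed
  obtain c0 where c0: "c0 \<in> K" "cmod c0 = 1" "x0 = c0 \<odot> z"
  proof -
    obtain c where c: "c \<in> K" "cmod c = 1" "(\<lambda>n :: nat. vnorm X (x0 \<ominus> c \<odot> z)) \<longlonglongrightarrow> 0"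
      using pull_back[of "\<lambda>_. x0"] x0b Sx0 by auto
    then have "ndist X x0 (c \<odot> z) = 0" by (simp add: ndist_def LIMSEQ_const_iff)
    then show thesis
      using that c Metric_space.zero[OF Metric_space_ndist, of x0 "c \<odot> z"] by simp
  qed
  obtain g where gd: "g \<in> dual K X" and gx0: "g (S x0) = 1"
    and g_le: "\<And>x. x \<in> carrier X \<Longrightarrow> cmod (g x) \<le> vnorm X x"
    using exists_norming_functional[of "S x0"] Sx0 by auto
  define f where "f x = g (S x)" for x
  have f_le: "cmod (f x) \<le> vnorm X (S x)" if "x \<in> carrier X" for x
    using g_le that by (simp add: f_def)
  have f_le1: "cmod (f x) \<le> vnorm X x" if "x \<in> carrier X" for x
    using f_le[OF that] S_le[OF that] by simp
  have fx0: "f x0 = 1" by (simp add: f_def gx0)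
  have fd: "f \<in> dual K X"
    using gd f_le1 by (auto simp: in_dual_iff f_def Sadd Ss Pi_iff intro!: exI[of _ 1])
  then have fadd: "\<And>x y. x \<in> carrier X \<Longrightarrow> y \<in> carrier X \<Longrightarrow> f (x \<oplus> y) = f x + f y"
    and fs: "\<And>a x. a \<in> K \<Longrightarrow> x \<in> carrier X \<Longrightarrow> f (a \<odot> x) = a * f x"
    by (auto simp: in_dual_iff)
  have fdiff: "f (x \<ominus> y) = f x - f y" if "x \<in> carrier X" "y \<in> carrier X" for x y
    using that by (simp add: a_minus_def fadd minus_eq_smult fs)
  have sup: "(SUP x\<in>unit_ball X. Re (f x)) = Re (f x0)"
  proof (rule cSup_eq_maximum)
    show "y \<le> Re (f x0)" if "y \<in> (\<lambda>x. Re (f x)) ` unit_ball X" for y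
      using that f_le1 complex_Re_le_cmod by (force simp: fx0 unit_ball_def intro: order_trans)
  qed (use x0b in auto)
  have exposes: "limitin (norm_topology X) x x0 sequentially"
    if x: "range x \<subseteq> unit_ball X" and lim: "(\<lambda>n. Re (f (x n))) \<longlonglongrightarrow> 1" for x :: "nat \<Rightarrow> 'a"
  proof (rule limitin_of_subsequences)
    have xb: "x n \<in> carrier X" "vnorm X (x n) \<le> 1" for n
      using x by (auto simp: unit_ball_def)
    show "x0 \<in> carrier X" "\<And>n. x n \<in> carrier X" using xb by auto
    fix r :: "nat \<Rightarrow> nat" assume r: "strict_mono r"
    have lim_r: "(\<lambda>n. Re (f (x (r n)))) \<longlonglongrightarrow> 1"
      using LIMSEQ_subseq_LIMSEQ[OF lim r] by (simp add: o_def)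
    then have "(\<lambda>n. vnorm X (S (x (r n)))) \<longlonglongrightarrow> 1"
    proof (rule real_tendsto_sandwich[OF _ _ _ tendsto_const, rotated 2])
      show "\<forall>\<^sub>F n in sequentially. Re (f (x (r n))) \<le> vnorm X (S (x (r n)))"
        using order_trans[OF complex_Re_le_cmod f_le] xb by simp
      show "\<forall>\<^sub>F n in sequentially. vnorm X (S (x (r n))) \<le> 1"
        using order_trans[OF S_le] xb by simp
    qed
    then obtain t :: "nat \<Rightarrow> nat" and c where t: "strict_mono t" and c: "c \<in> K" "cmod c = 1"
      and l: "(\<lambda>n. vnorm X (x (r (t n)) \<ominus> c \<odot> z)) \<longlonglongrightarrow> 0"
      using pull_back[of "\<lambda>n. x (r n)"] x by blast
    have "(\<lambda>n. f (x (r (t n))) - f (c \<odot> z)) \<longlonglongrightarrow> 0"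
    proof (rule Lim_null_comparison[OF _ l])
      show "\<forall>\<^sub>F n in sequentially.
          norm (f (x (r (t n))) - f (c \<odot> z)) \<le> vnorm X (x (r (t n)) \<ominus> c \<odot> z)"
        using f_le1 fdiff xb c by (metis (no_types, lifting) M.minus_closed always_eventually
            scale_closed zc)
    qed
    then have "(\<lambda>n. f (x (r (t n)))) \<longlonglongrightarrow> f (c \<odot> z)"
      by (simp add: LIM_zero_iff)
    then have "(\<lambda>n. Re (f (x (r (t n))))) \<longlonglongrightarrow> Re (f (c \<odot> z))"
      by (rule tendsto_Re)
    moreover have "(\<lambda>n. Re (f (x (r (t n))))) \<longlonglongrightarrow> 1"
      using LIMSEQ_subseq_LIMSEQ[OF lim_r t] by (simp add: o_def)
    ultimately have Re1: "Re (f (c \<odot> z)) = 1" by (rule LIMSEQ_unique)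
    have fz: "c0 * f z = 1" using fx0 c0 fs[of c0 z] by simp
    \<comment> \<open>Since \<open>f z = 1 / c0\<close>, the number \<open>f (c \<odot> z)\<close> has modulus and real part \<open>1\<close>.\<close>
    have "cmod (c * f z) = 1"
      using fz c c0 by (metis norm_mult norm_one mult.left_neutral)
    then have "(Im (c * f z))\<^sup>2 = 0"
      using Re1 fs[of c z] c cmod_power2[of "c * f z"] by simp
    then have "c * f z = 1"
      using Re1 fs[of c z] c by (simp add: complex_eq_iff)
    then have "c = c0" using fz by (metis mult_cancel_right mult_zero_right zero_neq_one)
    then show "\<exists>t :: nat \<Rightarrow> nat. (\<lambda>n. vnorm X (x (r (t n)) \<ominus> x0)) \<longlonglongrightarrow> 0"
      using l c0 by blast
  qed
  have "\<exists>x\<in>carrier X. f x \<noteq> 0" using fx0 x0c by (metis zero_neq_one)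
  then show ?thesis
    using fd sup exposes x0b fx0 unfolding strongly_exposed_points_def by auto
qed

text \<open>Every point of the sphere is a norm attaining point of the identity, so the property moves
  it slightly to a norm attaining point of a range strongly exposing perturbation.\<close>

theorem dense_strongly_exposed_points_if_BPBp_RSE:
  assumes "BPBp_RSE K X X"
  shows "dense_in_sphere X (strongly_exposed_points K X)"
proof -
  have approx: "\<exists>x0\<in>strongly_exposed_points K X. vnorm X (x \<ominus> x0) < e"
    if x: "x \<in> unit_sphere X" and e: "e > 0" for x e
  proof -
    \<comment> \<open>The bound \<open>1\<close> keeps the perturbation of the identity bounded below.\<close>
    have "min e 1 > 0" using e by simp
    then obtain \<eta> where \<eta>: "0 < \<eta>" and
      "\<forall>T\<in>bounded_ops K X X. \<forall>x\<in>unit_sphere X.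
        op_norm X X T = 1 \<and> vnorm X (T x) > 1 - \<eta> \<longrightarrow>
        (\<exists>S\<in>RSE K X X. \<exists>x0\<in>unit_sphere X.
           op_norm X X S = 1 \<and> vnorm X (S x0) = 1
           \<and> op_norm X X (\<lambda>u. S u \<ominus> T u) < min e 1
           \<and> vnorm X (x \<ominus> x0) < min e 1)"
      using assms unfolding BPBp_RSE_def by blast
    from this(2)[rule_format, OF id_bounded_op x] obtain S x0
      where S: "S \<in> RSE K X X" "op_norm X X S = 1"
        and x0: "x0 \<in> unit_sphere X" "vnorm X (S x0) = 1"
        and near: "op_norm X X (\<lambda>u. S u \<ominus> u) < min e 1" "vnorm X (x \<ominus> x0) < min e 1"
      using op_norm_id[OF x] x \<eta> by (auto simp: unit_sphere_def)
    have "S \<in> bounded_ops K X X" using S by (simp add: RSE_def)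
    then have "x0 \<in> strongly_exposed_points K X"
      by (intro strongly_exposed_point_if_RSE_bounded_below[OF S x0 _ bounded_below_near_id])
        (use near in auto)
    then show ?thesis using near by auto
  qed
  have "unit_sphere X \<subseteq> norm_topology X closure_of strongly_exposed_points K X"
  proof
    fix x assume x: "x \<in> unit_sphere X"
    have xc: "x \<in> carrier X" using x by (simp add: unit_sphere_def)
    have "\<exists>y\<in>strongly_exposed_points K X. y \<in> Metric_space.mball (carrier X) (ndist X) x r"
      if r: "r > 0" for r
    proof -
      obtain x0 where x0: "x0 \<in> strongly_exposed_points K X" "vnorm X (x \<ominus> x0) < r"
        using approx[OF x r] by blast
      then have "x0 \<in> carrier X"
        using strongly_exposed_points_subset_sphere by (auto simp: unit_sphere_def)
      with x0 xc show ?thesis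
        by (auto simp: Metric_space.in_mball[OF Metric_space_ndist] ndist_def)
    qed
    then show "x \<in> norm_topology X closure_of strongly_exposed_points K X"
      using xc
      by (simp add: norm_topology_def Metric_space.metric_closure_of[OF Metric_space_ndist])
  qed
  then show ?thesis
    using strongly_exposed_points_subset_sphere by (simp add: dense_in_sphere_def)
qed

end

theorem corollary5p4:
  fixes K :: "complex set" and X :: "'a nspace"
  assumes "banach_space K X" and "dim_ge_two K X"
  shows "(BPBp_RSE K X X \<longrightarrow> dense_in_sphere X (strongly_exposed_points K X))
    \<and> (universal_BPBp_RSE_domain K X \<longrightarrow> dense_in_sphere X (strongly_exposed_points K X))
    \<and> (universal_BPBp_RSE_range K X \<longrightarrow> dense_in_sphere X (strongly_exposed_points K X))"
proof -
  interpret banach_space K X by (fact assms(1))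
  show ?thesis
    using dense_strongly_exposed_points_if_BPBp_RSE assms
    by (simp add: universal_BPBp_RSE_domain_def universal_BPBp_RSE_range_def)
qed

end
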